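(* Let $\alpha,\beta_0,\beta_1$ be positive integers, let $d\ge 2$ be an integer, and let $$\sigma=\frac{\beta_0-\alpha}{\beta_1}+\frac{L_d(\alpha)}{\beta_1F_d(\alpha)}.$$ Then $\sigma$ is an integer if and only if one of the following conditions holds: (1) $d=3$, $\alpha=1$ and $(\beta_0+1)/\beta_1$ is an integer; (2) $d=2$, $\alpha=1$ and $(\beta_0+2)/\beta_1$ is an integer; (3) $d=2$, $\alpha=2$ and $(\beta_0+1)/\beta_1$ is an integer.
   Context: The Fibonacci polynomials $F_n(q)$ and Lucas polynomials $L_n(q)$ are defined by $F_0(q)=0$, $F_1(q)=1$, $L_0(q)=2$, $L_1(q)=q$ and the common recurrence $X_n(q)=qX_{n-1}(q)+X_{n-2}(q)$ for $n\ge2$, $X\in\{F,L\}$. *)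

theory Defs
  imports Complex_Main "HOL-Computational_Algebra.Polynomial"
begin

fun fibonacci_poly :: "nat \<Rightarrow> int poly" where
  "fibonacci_poly 0 = 0"
| "fibonacci_poly (Suc 0) = 1"
| "fibonacci_poly (Suc (Suc n)) = [:0, 1:] * fibonacci_poly (Suc n) + fibonacci_poly n"

fun lucas_poly :: "nat \<Rightarrow> int poly" where
  "lucas_poly 0 = 2"
| "lucas_poly (Suc 0) = [:0, 1:]"
| "lucas_poly (Suc (Suc n)) = [:0, 1:] * lucas_poly (Suc n) + lucas_poly n"

end

theory Submission
  imports Defs
begin

text \<open>
  Since \<open>L\<^sub>d = q F\<^sub>d + 2 F\<^sub>d\<^sub>-\<^sub>1\<close>, one has \<open>\<sigma> \<beta>\<^sub>1 = \<beta>\<^sub>0 + 2 F\<^sub>d\<^sub>-\<^sub>1(\<alpha>) / F\<^sub>d(\<alpha>)\<close>. If \<open>\<sigma>\<close> is an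
  integer then \<open>F\<^sub>d(\<alpha>)\<close> divides \<open>2 F\<^sub>d\<^sub>-\<^sub>1(\<alpha>)\<close>, hence divides 2, because consecutive Fibonacci
  values are coprime. As \<open>F\<^sub>d(\<alpha>) \<ge> d - 1\<close>, only \<open>d = 2\<close> (with \<open>F\<^sub>2 = q\<close>) and \<open>d = 3\<close>
  (with \<open>F\<^sub>3 = q\<^sup>2 + 1\<close>) remain.
\<close>

lemma lucas_poly_Suc:
  "lucas_poly (Suc n) = [:0, 1:] * fibonacci_poly (Suc n) + 2 * fibonacci_poly n"
  by (induction n rule: fibonacci_poly.induct) (simp_all add: algebra_simps)

text \<open>One step of Euclid's algorithm: the recurrence makes \<open>?F (Suc (Suc n))\<close>
  congruent to \<open>?F n\<close> modulo \<open>?F (Suc n)\<close>.\<close>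

lemma coprime_poly_fibonacci_poly_Suc:
  "coprime (poly (fibonacci_poly (Suc n)) a) (poly (fibonacci_poly n) a)"
proof (induction n)
  case (Suc n)
  let ?F = "\<lambda>n. poly (fibonacci_poly n) a"
  have "gcd (?F (Suc (Suc n))) (?F (Suc n)) = gcd (?F (Suc n)) (a * ?F (Suc n) + ?F n)"
    by (subst gcd.commute) simp
  also have "\<dots> = 1"
    using Suc by (simp only: gcd_add_mult coprime_iff_gcd_eq_1)
  finally show ?case
    by (simp only: coprime_iff_gcd_eq_1)
qed simp

text \<open>The 1 in the maximum strengthens the induction: since \<open>a\<close> is at least 1,
  each value exceeds its predecessor by at least the one before that, which is positive.\<close>

lemma poly_fibonacci_poly_Suc_ge:
  assumes "a > 0"
  shows "poly (fibonacci_poly (Suc n)) a \<ge> max 1 (int n)"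
proof (induction n rule: fibonacci_poly.induct)
  case (3 n)
  have "1 * poly (fibonacci_poly (Suc (Suc n))) a \<le> a * poly (fibonacci_poly (Suc (Suc n))) a"
    using 3(1) assms by (intro mult_right_mono) auto
  moreover have "poly (fibonacci_poly (Suc (Suc (Suc n)))) a
      = a * poly (fibonacci_poly (Suc (Suc n))) a + poly (fibonacci_poly (Suc n)) a"
    by simp
  ultimately show ?case
    using 3 by linarith
qed (use assms in auto)

lemma poly_fibonacci_poly_dvd_2_iff:
  assumes "a > 0" and "d \<ge> 2"
  shows "poly (fibonacci_poly d) a dvd 2 \<longleftrightarrow> d = 3 \<and> a = 1 \<or> d = 2 \<and> (a = 1 \<or> a = 2)"
proof
  assume dvd: "poly (fibonacci_poly d) a dvd 2"
  then have le: "poly (fibonacci_poly d) a \<le> 2"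
    by (simp add: zdvd_imp_le)
  \<comment> \<open>The growth bound gives d - 1 \<le> 2.\<close>
  have "d = 2 \<or> d = 3"
    using poly_fibonacci_poly_Suc_ge[OF assms(1), of "d - 1"] le assms(2) by auto
  then show "d = 3 \<and> a = 1 \<or> d = 2 \<and> (a = 1 \<or> a = 2)"
  proof
    assume "d = 2"
    then show ?thesis
      using le assms(1) by (auto simp: numeral_2_eq_2)
  next
    assume "d = 3"
    then have "a * a \<le> 1"
      using le by (simp add: numeral_3_eq_3)
    moreover have "a * 1 \<le> a * a"
      using assms(1) by (intro mult_left_mono) auto
    ultimately have "a = 1"
      using assms(1) by linarith
    then show ?thesis
      using \<open>d = 3\<close> by simp
  qed
qed (auto simp: numeral_2_eq_2 numeral_3_eq_3)

theorem theorem6p1: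
  fixes \<alpha> \<beta>\<^sub>0 \<beta>\<^sub>1 :: int and d :: nat and \<sigma> :: real
  assumes "\<alpha> > 0" and "\<beta>\<^sub>0 > 0" and "\<beta>\<^sub>1 > 0" and "d \<ge> 2"
    and "\<sigma> = (real_of_int \<beta>\<^sub>0 - real_of_int \<alpha>) / real_of_int \<beta>\<^sub>1
          + real_of_int (poly (lucas_poly d) \<alpha>)
            / (real_of_int \<beta>\<^sub>1 * real_of_int (poly (fibonacci_poly d) \<alpha>))"
  shows "\<sigma> \<in> \<int> \<longleftrightarrow>
     (d = 3 \<and> \<alpha> = 1 \<and> (real_of_int \<beta>\<^sub>0 + 1) / real_of_int \<beta>\<^sub>1 \<in> \<int>)
   \<or> (d = 2 \<and> \<alpha> = 1 \<and> (real_of_int \<beta>\<^sub>0 + 2) / real_of_int \<beta>\<^sub>1 \<in> \<int>)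
   \<or> (d = 2 \<and> \<alpha> = 2 \<and> (real_of_int \<beta>\<^sub>0 + 1) / real_of_int \<beta>\<^sub>1 \<in> \<int>)"
proof -
  obtain n where d: "d = Suc n"
    using \<open>d \<ge> 2\<close> by (cases d) auto
  define F where "F = poly (fibonacci_poly d) \<alpha>"
  define G where "G = poly (fibonacci_poly n) \<alpha>"
  have "F > 0"
    using poly_fibonacci_poly_Suc_ge[OF \<open>\<alpha> > 0\<close>, of n] by (simp add: F_def d)
  have "poly (lucas_poly d) \<alpha> = \<alpha> * F + 2 * G"
    by (simp only: d lucas_poly_Suc F_def G_def) simp
  then have "poly (lucas_poly d) \<alpha> / (\<beta>\<^sub>1 * real_of_int F) = (\<alpha> + 2 * G / F) / \<beta>\<^sub>1"
    using \<open>\<beta>\<^sub>1 > 0\<close> \<open>F > 0\<close> by (simp add: field_simps)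
  \<comment> \<open>The \<alpha> split off from the Lucas value cancels the one subtracted from
    \<open>\<beta>\<^sub>0\<close>.\<close>
  then have \<sigma>: "\<sigma> = (\<beta>\<^sub>0 + 2 * G / F) / \<beta>\<^sub>1"
    using assms(5) by (simp flip: F_def add: add_divide_distrib diff_divide_distrib)
  have "F dvd 2" if "\<sigma> \<in> \<int>"
  proof -
    obtain k where "\<sigma> = of_int k"
      using \<open>\<sigma> \<in> \<int>\<close> by (auto elim: Ints_cases)
    \<comment> \<open>Clearing denominators leaves an equation between integers cast to reals, so it
      yields divisibility.\<close>
    then have "real_of_int (2 * G) = real_of_int (F * (k * \<beta>\<^sub>1 - \<beta>\<^sub>0))"
      using \<sigma> \<open>\<beta>\<^sub>1 > 0\<close> \<open>F > 0\<close> by (simp add: field_simps)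
    then have "F dvd 2 * G"
      by (simp only: of_int_eq_iff) simp
    moreover have "coprime F G"
      using coprime_poly_fibonacci_poly_Suc by (simp only: F_def G_def d)
    ultimately show ?thesis
      by (simp add: coprime_dvd_mult_left_iff)
  qed
  then have "\<sigma> \<in> \<int> \<longrightarrow> d = 3 \<and> \<alpha> = 1 \<or> d = 2 \<and> (\<alpha> = 1 \<or> \<alpha> = 2)"
    using poly_fibonacci_poly_dvd_2_iff[OF \<open>\<alpha> > 0\<close> \<open>d \<ge> 2\<close>] by (simp add: F_def)
  \<comment> \<open>In the surviving cases \<sigma> is exactly the quotient in the claim, which
    settles both directions. Here \<open>F\<close> = 2 and \<open>G\<close> = 1.\<close>
  moreover have "\<sigma> = (\<beta>\<^sub>0 + 1) / \<beta>\<^sub>1" if "d = 3" "\<alpha> = 1"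
    using \<sigma> that d by (auto simp: F_def G_def numeral_3_eq_3)
  \<comment> \<open>Here \<open>F\<close> = \<alpha> and \<open>G\<close> = 1; the added term is 2
    for \<alpha> = 1 and 1 for \<alpha> = 2.\<close>
  moreover have "\<sigma> = (\<beta>\<^sub>0 + 2 / \<alpha>) / \<beta>\<^sub>1" if "d = 2"
    using \<sigma> that d by (auto simp: F_def G_def numeral_2_eq_2)
  ultimately show ?thesis
    by auto
qed

end
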